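(* Let $1\le p'<p$ be integers and $0<\beta<1$. Let $X=(X_1,\dots,X_p)$ be a random vector whose components are independent with $X_j\sim\mathcal N(0,\sigma_j^2)$, $\sigma_j>0$, for $j=1,\dots,p$. For each set $I\subset\{1,\dots,p\}$ with $|I|=p'$, let $B_I\subset\mathbb R^I$ be the fastPRIM box of probability $\beta$ on the projection of $X$ to the coordinates in $I$, and let $\mathcal B=\{B_I : |I|=p'\}$. Then $$\arg\min_{B\in\mathcal B}\mathrm{Vol}(B\mid\beta)=\mathbf B,$$ where $\mathbf B$ is the box corresponding to the $p'$ pettiest components; that is, $B_I$ has minimal volume in $\mathcal B$ if and only if $I$ is a set of $p'$ pettiest components (so the minimizer is unique whenever the choice of the $p'$ pettiest components is unique).
   Context: Pettiest components: a set $I\subset\{1,\dots,p\}$ with $|I|=p'$ is a set of $p'$ pettiest components if it indexes $p'$ components of smallest variance, i.e. $\sigma_i^2\le\sigma_j^2$ for all $i\in I$, $j\notin I$. fastPRIM box: for $I$ with $|I|=p'$, the fastPRIM box of probability $\beta$ is the axis-parallel box centered at the mean, $$B_I=\prod_{j\in I}\Big[q_j\big(\tfrac12(1-\beta^{1/p'})\big),\,q_j\big(\tfrac12(1+\beta^{1/p'})\big)\Big],$$ where $q_j(u)$ is the $u$-quantile of $X_j$. Thus each side has marginal probability $\beta^{1/p'}$. $\mathrm{Vol}(B\mid\beta)$ denotes the $p'$-dimensional Lebesgue measure of the box $B\in\mathcal B$. The family $\mathcal B$ is regarded as indexed by the $\binom{p}{p'}$ sets $I$. *)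

theory Defs
  imports "HOL-Probability.Probability"
begin

definition quantile :: "'a measure \<Rightarrow> ('a \<Rightarrow> real) \<Rightarrow> real \<Rightarrow> real" where
  "quantile M Y u = Inf {x. u \<le> cdf (distr M borel Y) x}"

text \<open>
  Points of \<open>\<real>\<^sup>I\<close> are the functions in \<open>I \<rightarrow>\<^sub>E UNIV\<close>, i.e. functions that are \<^const>\<open>undefined\<close>
  outside \<open>I\<close>.
\<close>

definition fastPRIM_box ::
    "'a measure \<Rightarrow> ('i \<Rightarrow> 'a \<Rightarrow> real) \<Rightarrow> real \<Rightarrow> 'i set \<Rightarrow> ('i \<Rightarrow> real) set" where
  "fastPRIM_box M X \<beta> I =
     (\<Pi>\<^sub>E j\<in>I. {quantile M (X j) (1 / 2 * (1 - \<beta> powr (1 / real (card I)))) ..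
              quantile M (X j) (1 / 2 * (1 + \<beta> powr (1 / real (card I))))})"

definition vol :: "'i set \<Rightarrow> ('i \<Rightarrow> real) set \<Rightarrow> ennreal" where
  "vol I B = emeasure (\<Pi>\<^sub>M j\<in>I. lborel) B"

definition component_sets :: "nat \<Rightarrow> nat \<Rightarrow> nat set set" where
  "component_sets p p' = {I. I \<subseteq> {1..p} \<and> card I = p'}"

definition pettiest :: "nat \<Rightarrow> nat \<Rightarrow> (nat \<Rightarrow> real) \<Rightarrow> nat set \<Rightarrow> bool" where
  "pettiest p p' \<sigma> I \<longleftrightarrow>
     I \<in> component_sets p p' \<and> (\<forall>i\<in>I. \<forall>j\<in>{1..p} - I. (\<sigma> i)\<^sup>2 \<le> (\<sigma> j)\<^sup>2)"

text \<open>
  The family of boxes is indexed by the sets \<open>I\<close>, so a minimizer is an index set.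
\<close>

definition minimal_volume ::
    "'a measure \<Rightarrow> (nat \<Rightarrow> 'a \<Rightarrow> real) \<Rightarrow> nat \<Rightarrow> nat \<Rightarrow> real \<Rightarrow> nat set \<Rightarrow> bool" where
  "minimal_volume M X p p' \<beta> I \<longleftrightarrow>
     is_arg_min (\<lambda>J. vol J (fastPRIM_box M X \<beta> J)) (\<lambda>J. J \<in> component_sets p p') I"

end

theory Submission
  imports Defs
begin

text \<open>
  By scaling, the \<open>u\<close>-quantile of \<open>X\<^sub>j\<close> is \<open>\<sigma>\<^sub>j\<close> times the \<open>u\<close>-quantile of the standard normal
  distribution. All boxes have the same number of sides and hence the same side probability, so
  \<open>Vol B\<^sub>I = \<Prod>\<^sub>j\<^sub>\<in>\<^sub>I \<sigma>\<^sub>j c\<close> with one constant \<open>c > 0\<close>. If \<open>I\<close> consists of pettiest components,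
  any bijection between \<open>I - J\<close> and \<open>J - I\<close> compares the two products factor by factor; if not,
  exchanging an offending pair of components strictly decreases the product.
\<close>

abbreviation std_normal :: "real measure" where
  "std_normal \<equiv> density lborel (\<lambda>x. ennreal (std_normal_density x))"

lemma real_distribution_std_normal: "real_distribution std_normal"
  by (simp add: real_distribution_def real_distribution_axioms_def prob_space_normal_density)

text \<open>A measure with a Lebesgue density has no atoms, and a distribution function is
  continuous exactly at the points of mass zero. The intermediate value argument below relies on
  this.\<close>

lemma isCont_cdf_std_normal: "isCont (cdf std_normal) x"
proof -
  interpret real_distribution std_normal by (rule real_distribution_std_normal)
  have "AE y in lborel. y \<in> {x} \<longrightarrow> ennreal (std_normal_density y) = 0"
    using AE_lborel_singleton[of x] by eventually_elim auto
  then have "{x} \<in> null_sets std_normal"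
    by (subst null_sets_density_iff) auto
  then show ?thesis
    by (simp add: isCont_cdf measure_eq_emeasure_eq_ennreal null_setsD1 measure_def)
qed

text \<open>The density vanishes nowhere, so an interval of normal mass zero would also be
  Lebesgue-null, contradicting its positive length.\<close>

lemma cdf_std_normal_strict_mono: "strict_mono (cdf std_normal)"
proof (rule strict_monoI)
  fix a b :: real
  assume ab: "a < b"
  interpret real_distribution std_normal by (rule real_distribution_std_normal)
  have "{a<..b} \<notin> null_sets std_normal"
  proof
    assume "{a<..b} \<in> null_sets std_normal"
    then have "AE x in lborel. x \<in> {a<..b} \<longrightarrow> ennreal (std_normal_density x) = 0"
      by (subst (asm) null_sets_density_iff) auto
    then have "AE x in lborel. x \<notin> {a<..b}"
      by eventually_elim (metis ennreal_eq_0_iff normal_density_pos less_le_not_le zero_less_one)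
    then have "{a<..b} \<in> null_sets lborel"
      by (subst AE_iff_null_sets) auto
    with ab show False by (auto simp: null_sets_def)
  qed
  then have "measure std_normal {a<..b} \<noteq> 0"
    by (auto simp: null_sets_def emeasure_eq_measure)
  then have "0 < measure std_normal {a<..b}"
    by (simp add: zero_less_measure_iff)
  with cdf_diff_eq[OF ab] show "cdf std_normal a < cdf std_normal b" by simp
qed

lemma ex_cdf_std_normal_eq:
  assumes "0 < u" "u < 1"
  shows "\<exists>z. cdf std_normal z = u"
proof -
  interpret real_distribution std_normal by (rule real_distribution_std_normal)
  have "eventually (\<lambda>x. cdf std_normal x < u) at_bot"
    using order_tendstoD(2)[OF cdf_lim_at_bot assms(1)] .
  then obtain a where a: "\<And>x. x \<le> a \<Longrightarrow> cdf std_normal x < u"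
    unfolding eventually_at_bot_linorder by blast
  have "eventually (\<lambda>x. u < cdf std_normal x) at_top"
    using order_tendstoD(1)[OF cdf_lim_at_top_prob assms(2)] .
  then obtain b where b: "\<And>x. b \<le> x \<Longrightarrow> u < cdf std_normal x"
    unfolding eventually_at_top_linorder by blast
  \<comment> \<open>Otherwise the value of the cdf at \<open>b\<close> would lie both below and
    above \<open>u\<close>.\<close>
  have "a \<le> b" using a[of b] b[of b] a[of a] b[of a] by (metis linear less_asym)
  then have "\<exists>x\<ge>a. x \<le> b \<and> cdf std_normal x = u"
    using a[of a] b[of b] isCont_cdf_std_normal by (intro IVT) auto
  then show ?thesis by blast
qed

text \<open>Dividing by \<sigma> makes the variable standard normal, and since \<sigma> is positive
  the events \<open>X w / \<sigma> \<le> x / \<sigma>\<close> and \<open>X w \<le> x\<close>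
  coincide.\<close>

lemma cdf_normal:
  fixes X :: "'a \<Rightarrow> real"
  assumes "prob_space M" "0 < \<sigma>" "distributed M lborel X (normal_density 0 \<sigma>)"
  shows "cdf (distr M borel X) x = cdf std_normal (x / \<sigma>)"
proof -
  interpret prob_space M by fact
  have X: "X \<in> borel_measurable M"
    using distributed_measurable[OF assms(3)] by simp
  have "distributed M lborel (\<lambda>w. X w / \<sigma>) std_normal_density"
    using normal_standard_normal_convert[OF assms(2), of X 0] assms(3) by simp
  then have std: "distr M borel (\<lambda>w. X w / \<sigma>) = std_normal"
    by (metis distributed_distr_eq_density distr_cong sets_lborel)
  have "cdf std_normal (x / \<sigma>) = measure M ((\<lambda>w. X w / \<sigma>) -` {..x / \<sigma>} \<inter> space M)"
    unfolding std[symmetric] cdf_def using X by (subst measure_distr) auto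
  also have "(\<lambda>w. X w / \<sigma>) -` {..x / \<sigma>} = X -` {..x}"
    using assms(2) by (auto simp: divide_le_cancel)
  also have "measure M (X -` {..x} \<inter> space M) = cdf (distr M borel X) x"
    unfolding cdf_def using X by (subst measure_distr) auto
  finally show ?thesis by simp
qed

text \<open>Writing the level as a cdf value lets strict monotonicity turn the set under the infimum
  into a closed half-line, so the quantile is simply its endpoint.\<close>

lemma quantile_normal:
  fixes X :: "'a \<Rightarrow> real"
  assumes "prob_space M" "0 < \<sigma>" "distributed M lborel X (normal_density 0 \<sigma>)"
  shows "quantile M X (cdf std_normal z) = \<sigma> * z"
proof -
  have "{x. cdf std_normal z \<le> cdf (distr M borel X) x} = {\<sigma> * z..}"
    using assms(2)
    by (auto simp: cdf_normal[OF assms] strict_mono_less_eq[OF cdf_std_normal_strict_mono]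
        pos_le_divide_eq mult.commute)
  then show ?thesis by (simp add: quantile_def)
qed

lemma vol_PiE_Icc:
  assumes "finite I" "\<And>j. j \<in> I \<Longrightarrow> a j \<le> b j"
  shows "vol I (\<Pi>\<^sub>E j\<in>I. {a j .. b j}) = ennreal (\<Prod>j\<in>I. b j - a j)"
proof -
  interpret product_sigma_finite "\<lambda>_. lborel :: real measure"
    by standard
  have "vol I (\<Pi>\<^sub>E j\<in>I. {a j .. b j}) = (\<Prod>j\<in>I. emeasure lborel {a j .. b j})"
    unfolding vol_def by (rule emeasure_PiM[OF assms(1)]) auto
  also have "\<dots> = (\<Prod>j\<in>I. ennreal (b j - a j))"
    by (intro prod.cong) (auto simp: assms(2))
  also have "\<dots> = ennreal (\<Prod>j\<in>I. b j - a j)"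
    by (intro prod_ennreal) (simp add: assms(2))
  finally show ?thesis .
qed

lemma prod_le_prod_exchange:
  fixes f :: "'i \<Rightarrow> 'b :: linordered_idom"
  assumes "finite I" "finite J" "card I = card J"
    and nonneg: "\<And>i. i \<in> I \<union> J \<Longrightarrow> 0 \<le> f i"
    and le: "\<And>i j. i \<in> I - J \<Longrightarrow> j \<in> J - I \<Longrightarrow> f i \<le> f j"
  shows "prod f I \<le> prod f J"
proof -
  have "card (I - J) = card (J - I)"
    using assms(1-3) by (simp add: card_Diff_subset_Int Int_commute)
  then obtain g where g: "bij_betw g (I - J) (J - I)"
    using assms(1,2) by (meson finite_Diff finite_same_card_bij)
  \<comment> \<open>The hypothesis compares every element of \<open>I - J\<close> with every element
    of \<open>J - I\<close>, so the choice of \<open>g\<close> is immaterial.\<close>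
  have "prod f (I - J) \<le> (\<Prod>i\<in>I - J. f (g i))"
    by (intro prod_mono conjI nonneg le) (use bij_betwE[OF g] in auto)
  also have "\<dots> = prod f (J - I)"
    by (rule prod.reindex_bij_betw[OF g])
  finally have "prod f (I \<inter> J) * prod f (I - J) \<le> prod f (I \<inter> J) * prod f (J - I)"
    by (intro mult_left_mono prod_nonneg) (auto intro: nonneg)
  then show ?thesis
    using prod.Int_Diff[OF assms(1), of f J] prod.Int_Diff[OF assms(2), of f I]
    by (simp add: Int_commute)
qed

lemma pettiest_iff_prod_le:
  assumes pos: "\<And>j. j \<in> {1..p} \<Longrightarrow> 0 < \<sigma> j"
    and I: "I \<in> component_sets p p'"
  shows "pettiest p p' \<sigma> I \<longleftrightarrow> (\<forall>J \<in> component_sets p p'. prod \<sigma> I \<le> prod \<sigma> J)"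
proof -
  \<comment> \<open>Pettiness is stated with variances, the volume involves standard deviations; for
    positive numbers both give the same order.\<close>
  have sq: "(\<sigma> i)\<^sup>2 \<le> (\<sigma> j)\<^sup>2 \<longleftrightarrow> \<sigma> i \<le> \<sigma> j" if "i \<in> {1..p}" "j \<in> {1..p}" for i j
    using pos[OF that(1)] pos[OF that(2)] by (intro power_mono_iff) auto
  have I_sub: "I \<subseteq> {1..p}" and card_I: "card I = p'"
    using I by (auto simp: component_sets_def)
  have fin: "finite I" using I_sub finite_subset by blast
  show ?thesis
  proof (intro iffI ballI)
    fix J assume pet: "pettiest p p' \<sigma> I" and "J \<in> component_sets p p'"
    then have J: "J \<subseteq> {1..p}" "card J = p'" by (auto simp: component_sets_def)
    show "prod \<sigma> I \<le> prod \<sigma> J"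
    proof (rule prod_le_prod_exchange)
      show "finite J" using J(1) finite_subset by blast
      show "0 \<le> \<sigma> i" if "i \<in> I \<union> J" for i
        using pos[of i] that I_sub J(1) by force
      show "\<sigma> i \<le> \<sigma> j" if "i \<in> I - J" "j \<in> J - I" for i j
      proof -
        have "i \<in> {1..p}" "j \<in> {1..p}" using that I_sub J(1) by blast+
        moreover have "(\<sigma> i)\<^sup>2 \<le> (\<sigma> j)\<^sup>2"
          using pet that \<open>j \<in> {1..p}\<close> unfolding pettiest_def by blast
        ultimately show ?thesis using sq by blast
      qed
    qed (use fin card_I J in simp_all)
  next
    assume min: "\<forall>J \<in> component_sets p p'. prod \<sigma> I \<le> prod \<sigma> J"
    have "\<sigma> i \<le> \<sigma> j" if i: "i \<in> I" and j: "j \<in> {1..p} - I" for i j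
    proof -
      let ?K = "I - {i}"
      \<comment> \<open>The competitor swaps \<open>i\<close> for \<open>j\<close>. Its product
        shares the positive factor \<open>prod \<sigma> ?K\<close> with that of \<open>I\<close>,
        and cancelling it leaves the desired inequality.\<close>
      have "insert j ?K \<in> component_sets p p'"
        using i j I_sub card_I fin
        by (auto simp: component_sets_def card_Suc_Diff1 simp del: card_Diff_insert)
      with min have "prod \<sigma> I \<le> prod \<sigma> (insert j ?K)" by blast
      also have "\<dots> = \<sigma> j * prod \<sigma> ?K" using fin j by simp
      finally have "\<sigma> i * prod \<sigma> ?K \<le> \<sigma> j * prod \<sigma> ?K"
        using prod.remove[OF fin i, of \<sigma>] by simp
      moreover have "0 < prod \<sigma> ?K" using pos I_sub by (intro prod_pos) auto
      ultimately show ?thesis by simp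
    qed
    then show "pettiest p p' \<sigma> I"
      unfolding pettiest_def using I I_sub sq by blast
  qed
qed

theorem theorem2:
  fixes M :: "'a measure" and X :: "nat \<Rightarrow> 'a \<Rightarrow> real" and \<sigma> :: "nat \<Rightarrow> real"
    and p p' :: nat and \<beta> :: real
  assumes "prob_space M"
    and "1 \<le> p'" and "p' < p"
    and "0 < \<beta>" and "\<beta> < 1"
    and "\<And>j. j \<in> {1..p} \<Longrightarrow> 0 < \<sigma> j"
    and "prob_space.indep_vars M (\<lambda>_. borel) X {1..p}"
    and "\<And>j. j \<in> {1..p} \<Longrightarrow> distributed M lborel (X j) (normal_density 0 (\<sigma> j))"
  shows "(\<forall>I \<in> component_sets p p'. minimal_volume M X p p' \<beta> I \<longleftrightarrow> pettiest p p' \<sigma> I) \<and>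
         ((\<exists>!I. pettiest p p' \<sigma> I) \<longrightarrow> (\<exists>!I. minimal_volume M X p p' \<beta> I))"
proof -
  \<comment> \<open>The side probability depends only on \<open>p'\<close>, so the standard normal
    endpoints \<open>z1\<close> and \<open>z2\<close> obtained from it serve all boxes at
    once.\<close>
  define r where "r = \<beta> powr (1 / real p')"
  have r: "0 < r" "r < 1"
    using assms(2,4,5) by (simp_all add: r_def powr01_less_one)
  obtain z1 where z1: "cdf std_normal z1 = 1 / 2 * (1 - r)"
    using ex_cdf_std_normal_eq[of "1 / 2 * (1 - r)"] r by auto
  obtain z2 where z2: "cdf std_normal z2 = 1 / 2 * (1 + r)"
    using ex_cdf_std_normal_eq[of "1 / 2 * (1 + r)"] r by auto
  have "cdf std_normal z1 < cdf std_normal z2" using z1 z2 r by simp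
  then have z: "z1 < z2"
    by (simp add: strict_mono_less[OF cdf_std_normal_strict_mono])
  have pos: "0 < prod \<sigma> I" if "I \<in> component_sets p p'" for I
    using that assms(6) by (intro prod_pos) (auto simp: component_sets_def)
  have vol: "vol I (fastPRIM_box M X \<beta> I) = ennreal (prod \<sigma> I * (z2 - z1) ^ p')"
    if I: "I \<in> component_sets p p'" for I
  proof -
    have I_sub: "I \<subseteq> {1..p}" and card_I: "card I = p'"
      using I by (auto simp: component_sets_def)
    have q: "quantile M (X j) (cdf std_normal z) = \<sigma> j * z" if "j \<in> I" for j z
      using that I_sub by (intro quantile_normal assms(1,6,8)) auto
    have "fastPRIM_box M X \<beta> I = (\<Pi>\<^sub>E j\<in>I. {\<sigma> j * z1 .. \<sigma> j * z2})"
      unfolding fastPRIM_box_def card_I r_def[symmetric] z1[symmetric] z2[symmetric]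
      by (intro PiE_cong) (simp add: q)
    moreover have "\<sigma> j * z1 \<le> \<sigma> j * z2" if "j \<in> I" for j
      using that I_sub assms(6)[of j] z by (intro mult_left_mono) auto
    moreover have "finite I" using I_sub finite_subset by blast
    ultimately have "vol I (fastPRIM_box M X \<beta> I) = ennreal (\<Prod>j\<in>I. \<sigma> j * z2 - \<sigma> j * z1)"
      by (simp add: vol_PiE_Icc)
    also have "(\<Prod>j\<in>I. \<sigma> j * z2 - \<sigma> j * z1) = prod \<sigma> I * (z2 - z1) ^ p'"
      by (simp add: right_diff_distrib[symmetric] prod.distrib card_I)
    finally show ?thesis .
  qed
  \<comment> \<open>\<open>is_arg_min\<close> forbids a strictly smaller value, hence the strict
    comparison. The common factor \<open>(z2 - z1) ^ p'\<close> cancels because it is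
    positive.\<close>
  have vol_less: "vol J (fastPRIM_box M X \<beta> J) < vol I (fastPRIM_box M X \<beta> I)
      \<longleftrightarrow> prod \<sigma> J < prod \<sigma> I"
    if "I \<in> component_sets p p'" "J \<in> component_sets p p'" for I J
    using z pos[OF that(1)] pos[OF that(2)] by (simp add: vol that ennreal_less_iff)
  have iff: "minimal_volume M X p p' \<beta> I \<longleftrightarrow> pettiest p p' \<sigma> I"
    if I: "I \<in> component_sets p p'" for I
  proof -
    have "minimal_volume M X p p' \<beta> I
        \<longleftrightarrow> (\<forall>J \<in> component_sets p p'. prod \<sigma> I \<le> prod \<sigma> J)"
      unfolding minimal_volume_def is_arg_min_def using I vol_less[OF I] not_less by blast
    then show ?thesis using pettiest_iff_prod_le[OF assms(6) I] by simp
  qed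
  \<comment> \<open>Both predicates include membership in \<open>component_sets p p'\<close>, so
    they agree on all index sets and uniqueness carries over.\<close>
  moreover have "minimal_volume M X p p' \<beta> = pettiest p p' \<sigma>"
    using iff by (auto simp: fun_eq_iff minimal_volume_def is_arg_min_def pettiest_def)
  ultimately show ?thesis by simp
qed

end
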